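(* For each positive integer $n$, the binary partitions of $n$ can be arranged in a sequence $\mathcal B(n)$ (each binary partition of $n$ occurring exactly once) such that any two adjacent partitions in the sequence differ by an operation of the form $$\cdots+2^k+2^k+\cdots \;\longleftrightarrow\; \cdots+2^{k+1}+\cdots$$ for some $k\ge 0$, i.e. one is obtained from the other by replacing two parts equal to $2^k$ by a single part $2^{k+1}$. Moreover, the sequence runs first through all binary partitions of $n$ that have at least one part equal to $1$, and then through all binary partitions of $n$ that have no part equal to $1$.
   Context: A binary partition of a positive integer $n$ is a partition of $n$ (an unordered multiset of positive integers summing to $n$) in which every part is a power of two ($1,2,4,8,\dots$). *)

theory Defs
  imports "HOL-Library.Multiset"
begin

definition binary_partition :: "nat \<Rightarrow> nat multiset \<Rightarrow> bool" where
  "binary_partition n P \<longleftrightarrow> sum_mset P = n \<and> (\<forall>p\<in>#P. \<exists>k. p = 2 ^ k)"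

definition merge_step :: "nat multiset \<Rightarrow> nat multiset \<Rightarrow> bool" where
  "merge_step P Q \<longleftrightarrow> (\<exists>k R. P = R + {#2 ^ k, 2 ^ k#} \<and> Q = R + {#2 ^ (k + 1)#})"

definition adjacent :: "nat multiset \<Rightarrow> nat multiset \<Rightarrow> bool" where
  "adjacent P Q \<longleftrightarrow> merge_step P Q \<or> merge_step Q P"

end

theory Submission
  imports Defs
begin

text \<open>
  Every binary partition of \<open>n\<close> is either \<open>1 + P\<close> with \<open>P\<close> a binary partition of \<open>n - 1\<close>, or
  (for even \<open>n\<close>) \<open>2 \<cdot> P\<close> with \<open>P\<close> a binary partition of \<open>n / 2\<close>. Correspondingly
  \<open>B(n)\<close> is \<open>1 + B(n - 1)\<close> followed, for even \<open>n\<close>, by \<open>2 \<cdot> B(n / 2)\<close>, the latter traversed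
  backwards if \<open>n / 2\<close> is odd. Since \<open>B(m)\<close> always starts with \<open>1 + \<dots> + 1\<close>, and
  \<open>B(m + 1) = 1 + B(m)\<close> for even \<open>m\<close>, this choice of directions makes the junction for
  \<open>n = 2m + 2\<close> a move \<open>1 + 1 + 2 \<cdot> P \<rightarrow> 2 \<cdot> (1 + P)\<close>, where \<open>P\<close> is the last element of \<open>B(m)\<close>
  if \<open>m\<close> is even and the first one if \<open>m\<close> is odd.
\<close>

abbreviation double :: "nat multiset \<Rightarrow> nat multiset" where
  "double \<equiv> image_mset ((*) 2)"

function gray :: "nat \<Rightarrow> nat multiset list" where
  "gray 0 = [{#}]"
| "gray (Suc n) = map (add_mset 1) (gray n) @
     (if even (Suc n)
      then map double (if even (Suc n div 2) then gray (Suc n div 2) else rev (gray (Suc n div 2)))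
      else [])"
  by pat_completeness auto

termination
  by (relation "measure id") (auto elim!: oddE)

lemma adjacent_sym: "adjacent P Q \<longleftrightarrow> adjacent Q P"
  by (auto simp: adjacent_def)

lemma merge_step_add_mset: "merge_step P Q \<Longrightarrow> merge_step (add_mset x P) (add_mset x Q)"
  unfolding merge_step_def by (metis union_mset_add_mset_left)

lemma adjacent_add_mset: "adjacent P Q \<Longrightarrow> adjacent (add_mset x P) (add_mset x Q)"
  by (auto simp: adjacent_def merge_step_add_mset)

lemma merge_step_double:
  assumes "merge_step P Q"
  shows "merge_step (double P) (double Q)"
proof -
  obtain k R where "P = R + {#2 ^ k, 2 ^ k#}" "Q = R + {#2 ^ (k + 1)#}"
    using assms by (auto simp: merge_step_def)
  then have "double P = double R + {#2 ^ Suc k, 2 ^ Suc k#}"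
    "double Q = double R + {#2 ^ (Suc k + 1)#}"
    by simp_all
  then show ?thesis
    unfolding merge_step_def by blast
qed

lemma adjacent_double: "adjacent P Q \<Longrightarrow> adjacent (double P) (double Q)"
  by (auto simp: adjacent_def merge_step_double)

text \<open>The move is a merge with \<open>k = 0\<close>: doubling the part 1 of
  \<open>add_mset 1 P\<close> produces the part 2.\<close>

lemma adjacent_junction: "adjacent (add_mset 1 (add_mset 1 (double P))) (double (add_mset 1 P))"
proof -
  have "merge_step (double P + {#2 ^ 0, 2 ^ 0#}) (double P + {#2 ^ (0 + 1)#})"
    unfolding merge_step_def by blast
  then show ?thesis
    by (simp add: adjacent_def)
qed

text \<open>By symmetry of \<open>adjacent\<close>, the doubled block may be traversed in either
  direction.\<close>

lemma successively_rev_adjacent: "successively adjacent (rev xs) \<longleftrightarrow> successively adjacent xs"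
  by (simp add: adjacent_sym)

lemma one_notin_double: "1 \<notin># double P"
  by auto

lemma inj_double: "inj double"
  by (rule multiset.inj_map) (simp add: inj_def)

lemma binary_partition_add_one:
  "binary_partition (Suc n) (add_mset 1 P) \<longleftrightarrow> binary_partition n P"
  by (auto simp: binary_partition_def intro: exI[of _ 0])

lemma sum_mset_double: "sum_mset (double P) = 2 * sum_mset P"
  by (induction P) auto

lemma binary_partition_double: "binary_partition (2 * n) (double P) \<longleftrightarrow> binary_partition n P"
proof -
  have "(\<exists>k. 2 * p = 2 ^ k) \<longleftrightarrow> (\<exists>k. p = 2 ^ k)" for p :: nat
  proof
    assume "\<exists>k. 2 * p = 2 ^ k"
    then obtain k where k: "2 * p = 2 ^ k" ..
    then show "\<exists>k. p = 2 ^ k"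
      \<comment> \<open>The case \<open>k = 0\<close> is impossible, since \<open>2 * p\<close> is
        not 1.\<close>
      by (cases k) auto
  next
    assume "\<exists>k. p = 2 ^ k"
    then show "\<exists>k. 2 * p = 2 ^ k"
      by (metis power_Suc)
  qed
  then show ?thesis
    by (auto simp: binary_partition_def sum_mset_double)
qed

text \<open>A power of two other than 1 is even, so halving every part of \<open>P\<close> is undone
  by \<open>double\<close>.\<close>

lemma binary_partition_without_one:
  assumes "binary_partition n P" "1 \<notin># P"
  obtains Q where "even n" "P = double Q" "binary_partition (n div 2) Q"
proof -
  have ev: "even p" if "p \<in># P" for p
  proof -
    obtain k where "p = 2 ^ k"
      using assms(1) \<open>p \<in># P\<close> unfolding binary_partition_def by blast
    then show ?thesis
      using assms(2) that by (cases k) auto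
  qed
  define Q where "Q = image_mset (\<lambda>p. p div 2) P"
  have "double Q = image_mset id P"
    unfolding Q_def multiset.map_comp by (rule image_mset_cong) (simp add: ev)
  then have P: "P = double Q"
    by simp
  have "n = sum_mset (double Q)"
    using assms(1) P by (simp add: binary_partition_def)
  then have n: "n = 2 * sum_mset Q"
    by (simp add: sum_mset_double)
  then have "binary_partition (2 * (n div 2)) (double Q)"
    using assms(1) P by simp
  then show thesis
    using that P n binary_partition_double by simp
qed

lemma gray_nonempty: "gray n \<noteq> []"
  by (induction n rule: gray.induct) auto

text \<open>The first block is nonempty, so the head is the same whether or not a doubled block
  follows.\<close>

lemma hd_gray_Suc: "hd (gray (Suc n)) = add_mset 1 (hd (gray n))"
  by (simp add: gray_nonempty hd_map)

lemma gray_odd: "even n \<Longrightarrow> gray (Suc n) = map (add_mset 1) (gray n)"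
  by simp

text \<open>Half of the argument is \<open>Suc m\<close>, so the evenness test in
  \<open>gray\<close> turns into \<open>odd m\<close>.\<close>

lemma gray_even:
  "gray (Suc (Suc (2 * m))) = map (add_mset 1) (gray (Suc (2 * m))) @
     map double (if odd m then gray (Suc m) else rev (gray (Suc m)))"
  by (subst gray.simps(2)) (simp del: gray.simps)

text \<open>For positive \<open>m\<close> the last element lies in the doubled block, which is
  reversed when \<open>m\<close> is odd and then ends with the image of the head of
  \<open>gray m\<close>. For \<open>m = 0\<close> both sides are \<open>{#}\<close>.\<close>

lemma last_gray_double:
  "last (gray (2 * m)) = double (if even m then last (gray m) else hd (gray m))"
proof (cases m)
  case (Suc j)
  have "last (gray (2 * m)) = last (map double (if even m then gray m else rev (gray m)))"
    unfolding Suc using gray_even[of j] gray_nonempty[of "Suc j"] by (simp del: gray.simps)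
  then show ?thesis
    using gray_nonempty[of m] by (simp add: last_map last_rev del: gray.simps)
qed simp

lemma set_gray: "set (gray n) = {P. binary_partition n P}"
proof (induction n rule: gray.induct)
  case 1
  have "P = {#}" if "binary_partition 0 P" for P
    using that by (cases P) (auto simp: binary_partition_def)
  then show ?case
    by (auto simp: binary_partition_def)
next
  case (2 n)
  have set_gray_Suc: "set (gray (Suc n)) = add_mset 1 ` {P. binary_partition n P} \<union>
      (if even (Suc n) then double ` {P. binary_partition (Suc n div 2) P} else {})"
    using 2 by (auto simp del: image_mset_add_mset)
  show ?case
  proof (intro equalityI subsetI)
    fix P assume "P \<in> set (gray (Suc n))"
    moreover have "binary_partition (Suc n) (double Q) \<longleftrightarrow> binary_partition (Suc n div 2) Q"
      if "even (Suc n)" for Q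
      using binary_partition_double[of "Suc n div 2" Q] that by (simp only: dvd_mult_div_cancel)
    ultimately show "P \<in> {P. binary_partition (Suc n) P}"
      unfolding set_gray_Suc by (auto simp: binary_partition_add_one
          simp del: One_nat_def even_Suc split: if_splits)
  next
    fix P assume "P \<in> {P. binary_partition (Suc n) P}"
    then have P: "binary_partition (Suc n) P"
      by simp
    show "P \<in> set (gray (Suc n))"
    proof (cases "1 \<in># P")
      case True
      then obtain Q where "P = add_mset 1 Q"
        by (metis mset_add)
      then show ?thesis
        using P binary_partition_add_one unfolding set_gray_Suc by blast
    next
      case False
      then show ?thesis
        using P binary_partition_without_one unfolding set_gray_Suc
        by (smt (verit) UnI2 image_eqI mem_Collect_eq)
    qed
  qed
qed

text \<open>The two blocks are disjoint because only the first has partitions containing 1; inside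
  each block an injective map preserves distinctness.\<close>

lemma distinct_gray: "distinct (gray n)"
proof (induction n rule: gray.induct)
  case (2 n)
  have "add_mset 1 P \<noteq> double Q" for P Q
    by (metis one_notin_double union_single_eq_member)
  then have "set (map (add_mset 1) xs) \<inter> set (map double ys) = {}" for xs ys
    by auto
  moreover have "inj_on (add_mset (1::nat)) A" for A
    by (simp add: inj_on_def)
  moreover have "inj_on double A" for A
    using inj_double by (rule inj_on_subset) simp
  ultimately show ?case
    using 2 by (simp add: distinct_map)
qed simp

lemma successively_map_adjacent:
  assumes "successively adjacent xs" "\<And>P Q. adjacent P Q \<Longrightarrow> adjacent (f P) (f Q)"
  shows "successively adjacent (map f xs)"
  unfolding successively_map by (rule successively_mono[OF assms(1)]) (rule assms(2))

lemma successively_gray: "successively adjacent (gray n)"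
proof (induction n rule: less_induct)
  case (less n)
  show ?case
  proof (cases "n = 0 \<or> odd n")
    case True
    then show ?thesis
    proof
      assume "odd n"
      then obtain m where n: "n = Suc (2 * m)"
        by (auto elim: oddE)
      then have "gray n = map (add_mset 1) (gray (2 * m))"
        using gray_odd[of "2 * m"] by simp
      then show ?thesis
        using less n by (simp add: successively_map_adjacent adjacent_add_mset)
    qed simp
  next
    case False
    then obtain m where n: "n = Suc (Suc (2 * m))"
      by (metis evenE mult_Suc_right nat.exhaust add_2_eq_Suc mult_0_right)
    define ys where "ys = (if odd m then gray (Suc m) else rev (gray (Suc m)))"
    have gray_n: "gray n = map (add_mset 1) (gray (Suc (2 * m))) @ map double ys"
      unfolding n ys_def by (rule gray_even)
    have "successively adjacent (map (add_mset 1) (gray (Suc (2 * m))))"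
      using less n by (intro successively_map_adjacent adjacent_add_mset) (simp_all del: gray.simps)
    moreover have "successively adjacent (map double ys)"
      using less[of "Suc m"] n
      by (intro successively_map_adjacent adjacent_double)
        (simp_all add: ys_def successively_rev_adjacent del: gray.simps successively_rev)
    moreover have "adjacent (last (map (add_mset 1) (gray (Suc (2 * m))))) (hd (map double ys))"
    proof -
      \<comment> \<open>\<open>P\<close> is chosen so that \<open>double P\<close> is the last
        element of \<open>gray (2 * m)\<close>; two added ones then give the last element before the
        junction.\<close>
      define P where "P = (if even m then last (gray m) else hd (gray m))"
      have "last (map (add_mset 1) (gray (Suc (2 * m)))) = add_mset 1 (add_mset 1 (double P))"
        using last_gray_double[of m] gray_odd[of "2 * m"]
        by (simp add: last_map gray_nonempty P_def del: gray.simps)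
      \<comment> \<open>For odd \<open>m\<close> this is the head of \<open>gray (Suc m)\<close>.
        For even \<open>m\<close> it is the last element of \<open>gray (Suc m)\<close>, which has
        no doubled block and so ends with the image of the last element of
        \<open>gray m\<close>.\<close>
      moreover have "hd ys = add_mset 1 P"
        using gray_odd[of m]
        by (simp add: ys_def P_def hd_gray_Suc hd_rev last_map gray_nonempty del: gray.simps)
      moreover have "ys \<noteq> []"
        by (simp add: ys_def gray_nonempty del: gray.simps)
      ultimately show ?thesis
        using adjacent_junction[of P] by (simp add: hd_map)
    qed
    ultimately show ?thesis
      unfolding gray_n successively_append_iff by blast
  qed
qed

theorem theorem1:
  fixes n :: nat
  assumes "n > 0"
  shows "\<exists>B :: nat multiset list.
           distinct B \<and> set B = {P. binary_partition n P} \<and>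
           successively adjacent B \<and>
           (\<exists>xs ys. B = xs @ ys \<and> (\<forall>P\<in>set xs. 1 \<in># P) \<and> (\<forall>P\<in>set ys. 1 \<notin># P))"
proof -
  obtain m where n: "n = Suc m"
    using assms gr0_implies_Suc by blast
  have "\<exists>xs ys. gray n = xs @ ys \<and> (\<forall>P\<in>set xs. 1 \<in># P) \<and> (\<forall>P\<in>set ys. 1 \<notin># P)"
    unfolding n gray.simps(2)
    \<comment> \<open>Unification with \<open>refl\<close> takes the two operands of the append in
      the recursion as \<open>xs\<close> and \<open>ys\<close>.\<close>
    by (rule exI, rule exI, rule conjI[OF refl]) (auto simp: one_notin_double)
  then show ?thesis
    using distinct_gray set_gray successively_gray by blast
qed

end
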